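(* Let $0<T\le+\infty$, $\rho\in(-1,1)$ and $q_r\in\mathbb{R}$. Assume that the constants $\sigma,\kappa,\theta\in(0,\infty)$ satisfy the Feller condition $\tfrac12\sigma^2-\kappa\theta<0$. Let $\gamma_0\in(0,\infty)$ be arbitrary and assume that $\beta_0,\mu_0\in(0,\infty)$ satisfy $$1\le\beta_0<\frac{2\kappa\theta}{\sigma^2}\quad\text{and}\quad\beta_0-1<\mu_0<\infty .$$ With $\mathbb{H}$, $\mathcal{A}$, $\mathfrak{h}_0$ as in the context, let $u\colon\mathbb{H}\times[0,T)\to\mathbb{R}$ satisfy $u\in C^0(\mathbb{H}\times[0,T))\cap C^{2,1}(\mathbb{H}\times(0,T))$ together with $$\frac{\partial u}{\partial t}+\mathcal{A}u\le0\ \text{ in }\mathbb{H}\times(0,T),\qquad u(x,\xi,t)\le C\,\mathfrak{h}_0(x,\xi)\ \text{ for }(x,\xi,t)\in\mathbb{H}\times(0,T),\qquad u(x,\xi,0)\le0\ \text{ for }(x,\xi)\in\mathbb{H},$$ where $C\in(0,\infty)$ is a constant independent of $(x,\xi,t)$. Then $u(x,\xi,t)\le0$ for all $(x,\xi,t)\in\mathbb{H}\times(0,T)$. In particular, the Cauchy problem $\frac{\partial u}{\partial t}+\mathcal{A}u=f(x,\xi,t)$ in $\mathbb{H}\times(0,T)$, $u(x,\xi,0)=u_0(x,\xi)$ for $(x,\xi)\in\mathbb{H}$ (with given real-valued $f$ and $u_0$), possesses at most one strong solution $u\in C^0(\mathbb{H}\times[0,T))\cap C^{2,1}(\mathbb{H}\times(0,T))$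 that satisfies the growth restriction $|u(x,\xi,t)|\le C\,\mathfrak{h}_0(x,\xi)$ for $(x,\xi,t)\in\mathbb{H}\times[0,T)$, where $C\in(0,\infty)$ is a constant.
   Context: $\mathbb{H}=\mathbb{R}\times(0,\infty)$ with points $(x,\xi)$. With $\theta_\sigma=\theta/\sigma$, the Heston operator is the differential expression $$(\mathcal{A}u)(x,\xi)=-\tfrac12\sigma\xi\bigl(u_{xx}+2\rho u_{x\xi}+u_{\xi\xi}\bigr)+\bigl(q_r+\tfrac12\sigma\xi\bigr)u_x-\kappa(\theta_\sigma-\xi)u_\xi .$$ The majorizing function $\mathfrak{h}_0\colon\mathbb{H}\to(0,\infty)$ is $$\mathfrak{h}_0(x,\xi)=\xi^{-(\beta_0-1)}\exp\bigl[\gamma_0(1+x^2)^{1/2}+\mu_0\xi\bigr].$$ $C^0(\mathbb{H}\times[0,T))$ is the space of continuous functions $u\colon\mathbb{H}\times[0,T)\to\mathbb{R}$; $C^{2,1}(\mathbb{H}\times(0,T))$ is the space of continuous $u\colon\mathbb{H}\times(0,T)\to\mathbb{R}$ with $u,u_t,u_x,u_\xi,u_{xx},u_{x\xi},u_{\xi\xi}$ all existing and continuous on $\mathbb{H}\times(0,T)$. A strong solution satisfies the equation pointwise. *)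

theory Defs
  imports "HOL-Analysis.Analysis"
begin

definition half_plane :: "(real \<times> real) set" where
  "half_plane = UNIV \<times> {0<..}"

text \<open>The horizon \<open>T\<close> is an extended real, so that \<open>T = \<infinity>\<close> is allowed; the elements of the
  intervals \<open>[0, T)\<close> and \<open>(0, T)\<close> are real numbers.\<close>

definition time_halfopen :: "ereal \<Rightarrow> real set" where
  "time_halfopen T = ereal -` {0..<T}"

definition time_open :: "ereal \<Rightarrow> real set" where
  "time_open T = ereal -` {0<..<T}"

definition D_x :: "(real \<Rightarrow> real \<Rightarrow> real) \<Rightarrow> real \<Rightarrow> real \<Rightarrow> real" where
  "D_x v x \<xi> = deriv (\<lambda>y. v y \<xi>) x"

definition D_xi :: "(real \<Rightarrow> real \<Rightarrow> real) \<Rightarrow> real \<Rightarrow> real \<Rightarrow> real" where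
  "D_xi v x \<xi> = deriv (\<lambda>\<eta>. v x \<eta>) \<xi>"

definition D_t :: "(real \<Rightarrow> real \<Rightarrow> real \<Rightarrow> real) \<Rightarrow> real \<Rightarrow> real \<Rightarrow> real \<Rightarrow> real" where
  "D_t u x \<xi> t = deriv (\<lambda>s. u x \<xi> s) t"

definition slice :: "(real \<Rightarrow> real \<Rightarrow> real \<Rightarrow> real) \<Rightarrow> real \<Rightarrow> real \<Rightarrow> real \<Rightarrow> real" where
  "slice u t = (\<lambda>x \<xi>. u x \<xi> t)"

definition cont_on_cylinder :: "real set \<Rightarrow> (real \<Rightarrow> real \<Rightarrow> real \<Rightarrow> real) \<Rightarrow> bool" where
  "cont_on_cylinder I u \<longleftrightarrow> continuous_on (half_plane \<times> I) (\<lambda>((x, \<xi>), t). u x \<xi> t)"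

text \<open>Functions on \<open>half_plane \<times> I\<close> are total functions whose values elsewhere are irrelevant. Since
  \<open>half_plane \<times> time_open T\<close> is open, the derivatives below depend only on the values there.
  The mixed derivative \<open>u\<^sub>x\<^sub>\<xi>\<close> is \<open>(u\<^sub>x)\<^sub>\<xi>\<close>. As \<open>deriv\<close> is total, existence of every
  derivative is required separately from its continuity.\<close>

definition C21 :: "ereal \<Rightarrow> (real \<Rightarrow> real \<Rightarrow> real \<Rightarrow> real) \<Rightarrow> bool" where
  "C21 T u \<longleftrightarrow>
     (\<forall>(x, \<xi>) \<in> half_plane. \<forall>t \<in> time_open T.
        (\<lambda>s. u x \<xi> s) field_differentiable at t \<and>
        (\<lambda>y. u y \<xi> t) field_differentiable at x \<and>
        (\<lambda>\<eta>. u x \<eta> t) field_differentiable at \<xi> \<and>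
        (\<lambda>y. D_x (slice u t) y \<xi>) field_differentiable at x \<and>
        (\<lambda>\<eta>. D_x (slice u t) x \<eta>) field_differentiable at \<xi> \<and>
        (\<lambda>\<eta>. D_xi (slice u t) x \<eta>) field_differentiable at \<xi>) \<and>
     cont_on_cylinder (time_open T) u \<and>
     cont_on_cylinder (time_open T) (D_t u) \<and>
     cont_on_cylinder (time_open T) (\<lambda>x \<xi> t. D_x (slice u t) x \<xi>) \<and>
     cont_on_cylinder (time_open T) (\<lambda>x \<xi> t. D_xi (slice u t) x \<xi>) \<and>
     cont_on_cylinder (time_open T) (\<lambda>x \<xi> t. D_x (D_x (slice u t)) x \<xi>) \<and>
     cont_on_cylinder (time_open T) (\<lambda>x \<xi> t. D_xi (D_x (slice u t)) x \<xi>) \<and>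
     cont_on_cylinder (time_open T) (\<lambda>x \<xi> t. D_xi (D_xi (slice u t)) x \<xi>)"

definition heston_op ::
  "real \<Rightarrow> real \<Rightarrow> real \<Rightarrow> real \<Rightarrow> real \<Rightarrow> (real \<Rightarrow> real \<Rightarrow> real) \<Rightarrow> real \<Rightarrow> real \<Rightarrow> real" where
  "heston_op \<sigma> \<rho> q\<^sub>r \<kappa> \<theta> v x \<xi> =
     - (1/2) * \<sigma> * \<xi> * (D_x (D_x v) x \<xi> + 2 * \<rho> * D_xi (D_x v) x \<xi> + D_xi (D_xi v) x \<xi>)
     + (q\<^sub>r + (1/2) * \<sigma> * \<xi>) * D_x v x \<xi>
     - \<kappa> * (\<theta> / \<sigma> - \<xi>) * D_xi v x \<xi>"

definition majorant :: "real \<Rightarrow> real \<Rightarrow> real \<Rightarrow> real \<Rightarrow> real \<Rightarrow> real" where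
  "majorant \<beta>\<^sub>0 \<gamma>\<^sub>0 \<mu>\<^sub>0 x \<xi> = \<xi> powr (- (\<beta>\<^sub>0 - 1)) * exp (\<gamma>\<^sub>0 * sqrt (1 + x\<^sup>2) + \<mu>\<^sub>0 * \<xi>)"

definition heston_strong_solution ::
  "ereal \<Rightarrow> real \<Rightarrow> real \<Rightarrow> real \<Rightarrow> real \<Rightarrow> real \<Rightarrow> (real \<Rightarrow> real \<Rightarrow> real \<Rightarrow> real) \<Rightarrow>
   (real \<Rightarrow> real \<Rightarrow> real) \<Rightarrow> (real \<Rightarrow> real \<Rightarrow> real \<Rightarrow> real) \<Rightarrow> bool" where
  "heston_strong_solution T \<sigma> \<rho> q\<^sub>r \<kappa> \<theta> f u\<^sub>0 u \<longleftrightarrow>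
     cont_on_cylinder (time_halfopen T) u \<and> C21 T u \<and>
     (\<forall>(x, \<xi>) \<in> half_plane. \<forall>t \<in> time_open T.
        D_t u x \<xi> t + heston_op \<sigma> \<rho> q\<^sub>r \<kappa> \<theta> (slice u t) x \<xi> = f x \<xi> t) \<and>
     (\<forall>(x, \<xi>) \<in> half_plane. u x \<xi> 0 = u\<^sub>0 x \<xi>)"

end

theory Submission
  imports Defs
begin

text \<open>
  The maximum principle rests on the barrier
  \<open>g = \<xi> powr (- b) * exp (\<gamma> * sqrt (1 + x\<^sup>2) + (m + K * (t - t\<^sub>0)) * \<xi> + \<omega> * (t - t\<^sub>0))\<close> with
  \<open>\<beta>\<^sub>0 - 1 < b < 2 * \<kappa> * \<theta> / \<sigma>\<^sup>2 - 1\<close>, \<open>\<gamma> > \<gamma>\<^sub>0\<close> and \<open>m > \<mu>\<^sub>0\<close>. It dominates every multiple of the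
  majorant outside a compact set. In \<open>(g\<^sub>t + \<A> g) / g\<close> the coefficient of \<open>1 / \<xi>\<close> is
  nonnegative by the choice of \<open>b\<close>, the term \<open>K * \<xi>\<close> beats the linear growth in \<open>\<xi>\<close>, and \<open>\<omega>\<close> beats
  the rest. As \<open>K\<close> depends on an upper bound for the coefficient \<open>m + K * (t - t\<^sub>0)\<close>, this works only on
  time intervals of length \<open>1 / K\<close>, but \<open>K\<close> does not depend on \<open>t\<^sub>0\<close>, so finitely many such steps
  reach any time. On each of them \<open>u - \<epsilon> g\<close> cannot have a positive maximum, because there
  \<open>u\<^sub>t + \<A> u \<ge> \<epsilon> (g\<^sub>t + \<A> g) > 0\<close>.
\<close>

section \<open>First- and second-order conditions at a maximum\<close>

text \<open>The closed segment lets the increment \<open>b - a\<close> have either sign or vanish,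
  as happens for the components of an arbitrary direction vector.\<close>

lemma Taylor_second_order:
  fixes f :: "real \<Rightarrow> real"
  assumes f: "\<And>z. z \<in> closed_segment a b \<Longrightarrow> (f has_real_derivative f' z) (at z)"
    and f': "\<And>z. z \<in> closed_segment a b \<Longrightarrow> (f' has_real_derivative f'' z) (at z)"
  shows "\<exists>z \<in> closed_segment a b. f b = f a + f' a * (b - a) + f'' z / 2 * (b - a)\<^sup>2"
proof (cases "a = b")
  case False
  define D where "D = (\<lambda>n::nat. if n = 0 then f else if n = 1 then f' else f'')"
  have "\<exists>t. (if b < a then b < t \<and> t < a else a < t \<and> t < b) \<and>
      f b = (\<Sum>m<2. D m a / fact m * (b - a) ^ m) + D 2 t / fact 2 * (b - a) ^ 2"
  proof (rule Taylor[where a = "min a b" and b = "max a b"])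
    show "\<forall>m t. m < 2 \<and> min a b \<le> t \<and> t \<le> max a b \<longrightarrow> (D m has_real_derivative D (Suc m) t) (at t)"
    proof (intro allI impI)
      fix m :: nat and t assume *: "m < 2 \<and> min a b \<le> t \<and> t \<le> max a b"
      then have "t \<in> closed_segment a b"
        by (auto simp: closed_segment_eq_real_ivl)
      moreover have "m = 0 \<or> m = 1" using * by auto
      ultimately show "(D m has_real_derivative D (Suc m) t) (at t)"
        using f f' by (auto simp: D_def)
    qed
  qed (use False in \<open>auto simp: D_def\<close>)
  then obtain t where t: "if b < a then b < t \<and> t < a else a < t \<and> t < b"
    and e: "f b = (\<Sum>m<2. D m a / fact m * (b - a) ^ m) + D 2 t / fact 2 * (b - a) ^ 2" by blast
  have "t \<in> closed_segment a b" using t by (auto simp: closed_segment_eq_real_ivl split: if_splits)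
  moreover have "f b = f a + f' a * (b - a) + f'' t / 2 * (b - a)\<^sup>2"
    using e by (simp add: D_def numeral_2_eq_2)
  ultimately show ?thesis by blast
qed auto

text \<open>A maximum over a closed time interval may sit at its final time, where only earlier
  times can be compared. This yields a sign of the time derivative instead of its vanishing.\<close>

lemma derivative_nonneg_at_left_max:
  fixes f :: "real \<Rightarrow> real"
  assumes "(f has_real_derivative l) (at t)" "s < t" "\<And>r. s < r \<Longrightarrow> r \<le> t \<Longrightarrow> f r \<le> f t"
  shows "0 \<le> l"
proof (rule ccontr)
  assume "\<not> 0 \<le> l"
  then obtain d where d: "d > 0" "\<And>h. 0 < h \<Longrightarrow> h < d \<Longrightarrow> f t < f (t - h)"
    using DERIV_neg_dec_left[OF assms(1)] by auto
  define h where "h = min (d/2) ((t - s)/2)"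
  have "0 < h" "h < d" "s < t - h" using d(1) assms(2) by (auto simp: h_def min_def field_simps)
  then show False using d(2)[of h] assms(3)[of "t - h"] by force
qed

text \<open>Taylor expansion first in \<open>x\<close>, then in \<open>y\<close> only meets the mixed derivative
  \<open>(f\<^sub>x)\<^sub>y\<close>, so its symmetry is not an issue.\<close>

lemma second_directional_derivative_nonpos:
  fixes f fx fy fxx fyy :: "real \<Rightarrow> real \<Rightarrow> real"
  assumes S: "open S" "(x0, y0) \<in> S"
    and fx: "\<And>x y. (x, y) \<in> S \<Longrightarrow> ((\<lambda>z. f z y) has_real_derivative fx x y) (at x)"
    and fy: "\<And>x y. (x, y) \<in> S \<Longrightarrow> ((\<lambda>z. f x z) has_real_derivative fy x y) (at y)"
    and fxx: "\<And>x y. (x, y) \<in> S \<Longrightarrow> ((\<lambda>z. fx z y) has_real_derivative fxx x y) (at x)"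
    and fyy: "\<And>x y. (x, y) \<in> S \<Longrightarrow> ((\<lambda>z. fy x z) has_real_derivative fyy x y) (at y)"
    and fxy: "((\<lambda>z. fx x0 z) has_real_derivative fxy) (at y0)"
    and cxx: "continuous_on S (\<lambda>(x, y). fxx x y)"
    and cyy: "continuous_on S (\<lambda>(x, y). fyy x y)"
    and crit: "fx x0 y0 = 0" "fy x0 y0 = 0"
    and max: "\<And>x y. (x, y) \<in> S \<Longrightarrow> f x y \<le> f x0 y0"
  shows "a\<^sup>2 * fxx x0 y0 + 2 * a * b * fxy + b\<^sup>2 * fyy x0 y0 \<le> 0"
proof -
  obtain e where e: "e > 0" "ball (x0, y0) e \<subseteq> S"
    using S by (auto simp: open_contains_ball)
  have box: "(x, y) \<in> S" if "\<bar>x - x0\<bar> < e / 2" "\<bar>y - y0\<bar> < e / 2" for x y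
  proof -
    have "dist (x0, y0) (x, y) \<le> \<bar>x - x0\<bar> + \<bar>y - y0\<bar>"
      using sqrt_sum_squares_le_sum_abs[of "x0 - x" "y0 - y"]
      by (simp add: dist_prod_def dist_real_def abs_minus_commute)
    also have "\<dots> < e" using that by linarith
    finally show ?thesis using e by (auto simp: mem_ball)
  qed
  \<comment> \<open>For \<open>0 < s < c\<close> both increments \<open>a * s\<close> and
    \<open>b * s\<close> stay below \<open>e / 2\<close>, hence inside the box. The summand 1 keeps
    the denominator positive when \<open>a = b = 0\<close>.\<close>
  define c where "c = e / 2 / (\<bar>a\<bar> + \<bar>b\<bar> + 1)"
  have c: "c > 0" using e by (auto simp: c_def intro!: divide_pos_pos)
  have small: "\<bar>a * s\<bar> < e / 2" "\<bar>b * s\<bar> < e / 2" if "0 < s" "s < c" for s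
  proof -
    have "(\<bar>a\<bar> + \<bar>b\<bar> + 1) * s < e / 2" using that by (auto simp: c_def field_simps)
    moreover have "\<bar>a\<bar> * s + \<bar>b\<bar> * s + s = (\<bar>a\<bar> + \<bar>b\<bar> + 1) * s" by (simp add: algebra_simps)
    moreover have "0 \<le> \<bar>a\<bar> * s" "0 \<le> \<bar>b\<bar> * s" using that by auto
    ultimately have "\<bar>a\<bar> * s < e / 2" "\<bar>b\<bar> * s < e / 2"
      using that by linarith+
    then show "\<bar>a * s\<bar> < e / 2" "\<bar>b * s\<bar> < e / 2"
      using that by (simp_all add: abs_mult)
  qed
  \<comment> \<open>The increment of \<open>f\<close> from \<open>(x0, y0)\<close> to
    \<open>(x0 + a * s, y0 + b * s)\<close> is nonpositive. It is expanded in \<open>x\<close> at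
    height \<open>y0 + b * s\<close> and in \<open>y\<close> along \<open>x = x0\<close>, and then
    divided by \<open>s\<^sup>2\<close>. The first-order term in \<open>x\<close> survives because
    it is taken at \<open>y0 + b * s\<close>.\<close>
  have "\<exists>p q. p \<in> closed_segment x0 (x0 + a * s) \<and> q \<in> closed_segment y0 (y0 + b * s) \<and>
      a / s * fx x0 (y0 + b * s) + a\<^sup>2 / 2 * fxx p (y0 + b * s) + b\<^sup>2 / 2 * fyy x0 q \<le> 0"
    if s: "0 < s" "s < c" for s
  proof -
    have seg: "\<bar>z - w\<bar> < e / 2" if "z \<in> closed_segment w (w + v)" "\<bar>v\<bar> < e / 2" for z w v :: real
      using that by (auto simp: closed_segment_eq_real_ivl split: if_splits)
    obtain p where p: "p \<in> closed_segment x0 (x0 + a * s)"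
      "f (x0 + a * s) (y0 + b * s) = f x0 (y0 + b * s) + fx x0 (y0 + b * s) * (x0 + a * s - x0)
        + fxx p (y0 + b * s) / 2 * (x0 + a * s - x0)\<^sup>2"
      using Taylor_second_order[of x0 "x0 + a * s" "\<lambda>z. f z (y0 + b * s)" "\<lambda>z. fx z (y0 + b * s)" "\<lambda>z. fxx z (y0 + b * s)"]
        fx fxx box small[OF s] seg by (metis add_diff_cancel_left')
    obtain q where q: "q \<in> closed_segment y0 (y0 + b * s)"
      "f x0 (y0 + b * s) = f x0 y0 + fy x0 y0 * (y0 + b * s - y0) + fyy x0 q / 2 * (y0 + b * s - y0)\<^sup>2"
      using Taylor_second_order[of y0 "y0 + b * s" "f x0" "fy x0" "fyy x0"] fy fyy box small[OF s] seg e(1)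
      by (metis abs_zero cancel_comm_monoid_add_class.diff_cancel half_gt_zero)
    have "f (x0 + a * s) (y0 + b * s) \<le> f x0 y0"
      using max box small[OF s] by simp
    then have "0 \<ge> fx x0 (y0 + b * s) * (a * s) + fxx p (y0 + b * s) / 2 * (a * s)\<^sup>2 + fyy x0 q / 2 * (b * s)\<^sup>2"
      using p(2) q(2) crit by simp
    also have "fx x0 (y0 + b * s) * (a * s) + fxx p (y0 + b * s) / 2 * (a * s)\<^sup>2 + fyy x0 q / 2 * (b * s)\<^sup>2
      = s\<^sup>2 * (a / s * fx x0 (y0 + b * s) + a\<^sup>2 / 2 * fxx p (y0 + b * s) + b\<^sup>2 / 2 * fyy x0 q)"
      using s by (simp add: field_simps power2_eq_square)
    finally have "a / s * fx x0 (y0 + b * s) + a\<^sup>2 / 2 * fxx p (y0 + b * s) + b\<^sup>2 / 2 * fyy x0 q \<le> 0"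
      using s by (simp add: mult_le_0_iff)
    then show ?thesis using p(1) q(1) by blast
  qed
  then obtain p q where
    p: "\<And>s. 0 < s \<Longrightarrow> s < c \<Longrightarrow> p s \<in> closed_segment x0 (x0 + a * s)" and
    q: "\<And>s. 0 < s \<Longrightarrow> s < c \<Longrightarrow> q s \<in> closed_segment y0 (y0 + b * s)" and
    pq: "\<And>s. 0 < s \<Longrightarrow> s < c \<Longrightarrow>
      a / s * fx x0 (y0 + b * s) + a\<^sup>2 / 2 * fxx (p s) (y0 + b * s) + b\<^sup>2 / 2 * fyy x0 (q s) \<le> 0"
    by metis
  have ev: "\<forall>\<^sub>F s in at_right 0. 0 < s \<and> s < c"
    using c eventually_at_right_field by blast
  have squeeze: "(r \<longlongrightarrow> w) (at_right 0)"
    if "\<And>s. 0 < s \<Longrightarrow> s < c \<Longrightarrow> r s \<in> closed_segment w (w + v * s)" for r w v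
  proof -
    have "\<forall>\<^sub>F s in at_right 0. norm (r s - w) \<le> \<bar>v\<bar> * s"
      using ev
    proof eventually_elim
      case (elim s)
      have "\<bar>r s - w\<bar> \<le> \<bar>v * s\<bar>"
        using that[of s] elim by (auto simp: closed_segment_eq_real_ivl split: if_splits)
      then show ?case using elim by (simp add: abs_mult)
    qed
    moreover have "((\<lambda>s. \<bar>v\<bar> * s) \<longlongrightarrow> 0) (at_right 0)"
      by (auto intro!: tendsto_eq_intros)
    ultimately have "((\<lambda>s. r s - w) \<longlongrightarrow> 0) (at_right 0)"
      by (rule Lim_null_comparison)
    then show ?thesis by (simp add: LIM_zero_iff)
  qed
  have isxx: "isCont (\<lambda>(x, y). fxx x y) (x0, y0)" and isyy: "isCont (\<lambda>(x, y). fyy x y) (x0, y0)"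
    using cxx cyy S continuous_on_eq_continuous_at by blast+
  have y: "((\<lambda>s. y0 + b * s) \<longlongrightarrow> y0) (at_right 0)"
    by (auto intro!: tendsto_eq_intros)
  have "((\<lambda>s. case (p s, y0 + b * s) of (x, y) \<Rightarrow> fxx x y) \<longlongrightarrow> (case (x0, y0) of (x, y) \<Rightarrow> fxx x y)) (at_right 0)"
    by (rule isCont_tendsto_compose[OF isxx tendsto_Pair[OF squeeze[OF p] y]])
  then have lxx: "((\<lambda>s. fxx (p s) (y0 + b * s)) \<longlongrightarrow> fxx x0 y0) (at_right 0)" by simp
  have "((\<lambda>s. case (x0, q s) of (x, y) \<Rightarrow> fyy x y) \<longlongrightarrow> (case (x0, y0) of (x, y) \<Rightarrow> fyy x y)) (at_right 0)"
    by (rule isCont_tendsto_compose[OF isyy tendsto_Pair[OF tendsto_const squeeze[OF q]]])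
  then have lyy: "((\<lambda>s. fyy x0 (q s)) \<longlongrightarrow> fyy x0 y0) (at_right 0)" by simp
  \<comment> \<open>Since \<open>fx x0 y0 = 0\<close>, the surviving term
    \<open>fx x0 (y0 + b * s) / s\<close> is a difference quotient. Its limit produces the mixed
    derivative.\<close>
  have "((\<lambda>s. fx x0 (y0 + b * s)) has_real_derivative fxy * b) (at 0)"
    by (rule DERIV_chain'[where f = "\<lambda>s. y0 + b * s" and g = "fx x0"])
       (use fxy in \<open>auto intro!: derivative_eq_intros\<close>)
  then have "((\<lambda>s. (fx x0 (y0 + b * s) - fx x0 (y0 + b * 0)) / (s - 0)) \<longlongrightarrow> fxy * b) (at 0)"
    by (simp add: has_field_derivative_iff)
  then have "((\<lambda>s. fx x0 (y0 + b * s) / s) \<longlongrightarrow> fxy * b) (at_right 0)"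
    using crit by (simp add: filterlim_at_split)
  then have lxy: "((\<lambda>s. a / s * fx x0 (y0 + b * s)) \<longlongrightarrow> a * (fxy * b)) (at_right 0)"
    by (drule_tac tendsto_mult_left[where c = a]) (simp add: mult.commute)
  have "a * (fxy * b) + a\<^sup>2 / 2 * fxx x0 y0 + b\<^sup>2 / 2 * fyy x0 y0 \<le> 0"
  proof (rule tendsto_upperbound)
    show "((\<lambda>s. a / s * fx x0 (y0 + b * s) + a\<^sup>2 / 2 * fxx (p s) (y0 + b * s) + b\<^sup>2 / 2 * fyy x0 (q s))
      \<longlongrightarrow> a * (fxy * b) + a\<^sup>2 / 2 * fxx x0 y0 + b\<^sup>2 / 2 * fyy x0 y0) (at_right 0)"
      by (intro tendsto_intros lxx lyy lxy)
    show "\<forall>\<^sub>F s in at_right 0. a / s * fx x0 (y0 + b * s) + a\<^sup>2 / 2 * fxx (p s) (y0 + b * s) + b\<^sup>2 / 2 * fyy x0 (q s) \<le> 0"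
      using ev by eventually_elim (use pq in blast)
  qed auto
  then show ?thesis by (simp add: field_simps)
qed

section \<open>Jets of functions of class C^{2,1}\<close>

text \<open>The derivatives are explicit arguments, so that those of the barrier can be given by
  formulas and those of linear combinations by linearity. The set \<open>I\<close> may be a
  half-open interval, as the time derivative is two-sided also at its right end. Continuity in space
  is recorded for \<open>uxx\<close> and \<open>uyy\<close>, which are evaluated at the intermediate
  points of the Taylor expansions.\<close>

definition C21_jet ::
  "real set \<Rightarrow> (real \<Rightarrow> real \<Rightarrow> real \<Rightarrow> real) \<Rightarrow> (real \<Rightarrow> real \<Rightarrow> real \<Rightarrow> real) \<Rightarrow>
   (real \<Rightarrow> real \<Rightarrow> real \<Rightarrow> real) \<Rightarrow> (real \<Rightarrow> real \<Rightarrow> real \<Rightarrow> real) \<Rightarrow>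
   (real \<Rightarrow> real \<Rightarrow> real \<Rightarrow> real) \<Rightarrow> (real \<Rightarrow> real \<Rightarrow> real \<Rightarrow> real) \<Rightarrow>
   (real \<Rightarrow> real \<Rightarrow> real \<Rightarrow> real) \<Rightarrow> bool" where
  "C21_jet I u ut ux uy uxx uxy uyy \<longleftrightarrow>
     (\<forall>x y t. 0 < y \<longrightarrow> t \<in> I \<longrightarrow>
        ((\<lambda>s. u x y s) has_real_derivative ut x y t) (at t) \<and>
        ((\<lambda>z. u z y t) has_real_derivative ux x y t) (at x) \<and>
        ((\<lambda>z. u x z t) has_real_derivative uy x y t) (at y) \<and>
        ((\<lambda>z. ux z y t) has_real_derivative uxx x y t) (at x) \<and>
        ((\<lambda>z. ux x z t) has_real_derivative uxy x y t) (at y) \<and>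
        ((\<lambda>z. uy x z t) has_real_derivative uyy x y t) (at y)) \<and>
     (\<forall>t\<in>I. continuous_on half_plane (\<lambda>(x, y). uxx x y t) \<and>
            continuous_on half_plane (\<lambda>(x, y). uyy x y t))"

lemma C21_jetD:
  assumes "C21_jet I u ut ux uy uxx uxy uyy"
  shows "\<And>x y t. 0 < y \<Longrightarrow> t \<in> I \<Longrightarrow> ((\<lambda>s. u x y s) has_real_derivative ut x y t) (at t)"
    and "\<And>x y t. 0 < y \<Longrightarrow> t \<in> I \<Longrightarrow> ((\<lambda>z. u z y t) has_real_derivative ux x y t) (at x)"
    and "\<And>x y t. 0 < y \<Longrightarrow> t \<in> I \<Longrightarrow> ((\<lambda>z. u x z t) has_real_derivative uy x y t) (at y)"
    and "\<And>x y t. 0 < y \<Longrightarrow> t \<in> I \<Longrightarrow> ((\<lambda>z. ux z y t) has_real_derivative uxx x y t) (at x)"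
    and "\<And>x y t. 0 < y \<Longrightarrow> t \<in> I \<Longrightarrow> ((\<lambda>z. ux x z t) has_real_derivative uxy x y t) (at y)"
    and "\<And>x y t. 0 < y \<Longrightarrow> t \<in> I \<Longrightarrow> ((\<lambda>z. uy x z t) has_real_derivative uyy x y t) (at y)"
    and "\<And>t. t \<in> I \<Longrightarrow> continuous_on half_plane (\<lambda>(x, y). uxx x y t)"
    and "\<And>t. t \<in> I \<Longrightarrow> continuous_on half_plane (\<lambda>(x, y). uyy x y t)"
  using assms unfolding C21_jet_def by blast+

lemma C21_jet_subset:
  assumes "C21_jet I u ut ux uy uxx uxy uyy" "J \<subseteq> I"
  shows "C21_jet J u ut ux uy uxx uxy uyy"
  using assms unfolding C21_jet_def by blast

text \<open>Serves twice: for \<open>u - e * g\<close> with a barrier \<open>g\<close>, and with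
  \<open>e = 1\<close> for the difference of two solutions.\<close>

lemma C21_jet_diff_scaled:
  assumes u: "C21_jet I u ut ux uy uxx uxy uyy" and v: "C21_jet I v vt vx vy vxx vxy vyy"
  shows "C21_jet I (\<lambda>x y t. u x y t - e * v x y t)
    (\<lambda>x y t. ut x y t - e * vt x y t) (\<lambda>x y t. ux x y t - e * vx x y t)
    (\<lambda>x y t. uy x y t - e * vy x y t) (\<lambda>x y t. uxx x y t - e * vxx x y t)
    (\<lambda>x y t. uxy x y t - e * vxy x y t) (\<lambda>x y t. uyy x y t - e * vyy x y t)"
proof -
  note D = C21_jetD[OF u] C21_jetD[OF v]
  have c: "continuous_on half_plane (\<lambda>(x, y). p x y - e * q x y)"
    if "continuous_on half_plane (\<lambda>(x, y). p x y)" "continuous_on half_plane (\<lambda>(x, y). q x y)"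
    for p q :: "real \<Rightarrow> real \<Rightarrow> real"
    using that unfolding split_beta by (intro continuous_intros)
  show ?thesis
    unfolding C21_jet_def
    by (intro conjI allI impI ballI DERIV_diff DERIV_cmult c D)
qed

lemma open_half_plane: "open half_plane"
  unfolding half_plane_def by (intro open_Times) auto

lemma in_half_plane_iff [simp]: "(x, y) \<in> half_plane \<longleftrightarrow> 0 < y"
  by (simp add: half_plane_def)

section \<open>Comparison with a strict supersolution\<close>

text \<open>The Heston operator as a linear function of the jet at a single point, which turns
  inequalities at a maximum into plain algebra.\<close>

definition heston_expr ::
  "real \<Rightarrow> real \<Rightarrow> real \<Rightarrow> real \<Rightarrow> real \<Rightarrow> real \<Rightarrow> real \<Rightarrow> real \<Rightarrow> real \<Rightarrow> real \<Rightarrow> real \<Rightarrow> real" where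
  "heston_expr \<sigma> \<rho> q \<kappa> \<theta> y ux uy uxx uxy uyy =
     - (1/2) * \<sigma> * y * (uxx + 2 * \<rho> * uxy + uyy) + (q + (1/2) * \<sigma> * y) * ux
     - \<kappa> * (\<theta> / \<sigma> - y) * uy"

text \<open>If \<open>u\<close> were positive somewhere, so would be \<open>u - e * g\<close> for a
  small \<open>e\<close>. The growth condition confines its positive values to a compact set, so a
  positive maximum is attained, after time \<open>t0\<close> because of the initial condition. There
  the first- and second-order conditions contradict the strict inequality for
  \<open>g\<close>.\<close>

lemma comparison_with_barrier:
  fixes u g :: "real \<Rightarrow> real \<Rightarrow> real \<Rightarrow> real"
  assumes \<sigma>: "0 < \<sigma>" and \<rho>: "\<bar>\<rho>\<bar> \<le> 1"
    and uj: "C21_jet {t0<..t1} u ut ux uy uxx uxy uyy"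
    and gj: "C21_jet {t0<..t1} g gt gx gy gxx gxy gyy"
    and uc: "cont_on_cylinder {t0..t1} u" and gc: "cont_on_cylinder {t0..t1} g"
    and gpos: "\<And>x y t. 0 < y \<Longrightarrow> t \<in> {t0..t1} \<Longrightarrow> 0 < g x y t"
    and sub: "\<And>x y t. 0 < y \<Longrightarrow> t \<in> {t0<..t1} \<Longrightarrow>
      ut x y t + heston_expr \<sigma> \<rho> q \<kappa> \<theta> y (ux x y t) (uy x y t) (uxx x y t) (uxy x y t) (uyy x y t) \<le> 0"
    and super: "\<And>x y t. 0 < y \<Longrightarrow> t \<in> {t0<..t1} \<Longrightarrow>
      0 < gt x y t + heston_expr \<sigma> \<rho> q \<kappa> \<theta> y (gx x y t) (gy x y t) (gxx x y t) (gxy x y t) (gyy x y t)"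
    and init: "\<And>x y. 0 < y \<Longrightarrow> u x y t0 \<le> 0"
    and growth: "\<And>e. 0 < e \<Longrightarrow> \<exists>K. compact K \<and> K \<subseteq> half_plane \<and>
      (\<forall>x y t. (x, y) \<in> half_plane - K \<longrightarrow> t \<in> {t0<..t1} \<longrightarrow> u x y t \<le> e * g x y t)"
    and pt: "0 < y" "t \<in> {t0..t1}"
  shows "u x y t \<le> 0"
proof (rule ccontr)
  assume "\<not> u x y t \<le> 0"
  \<comment> \<open>With this \<open>e\<close>, the difference \<open>u - e * g\<close> equals half
    of \<open>u\<close> at the given point and is still positive there.\<close>
  define e where "e = u x y t / (2 * g x y t)"
  have gp: "0 < g x y t" using gpos pt by blast
  have e: "0 < e" using gp \<open>\<not> u x y t \<le> 0\<close> by (simp add: e_def)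
  define w where "w = (\<lambda>x y t. u x y t - e * g x y t)"
  have wpos: "0 < w x y t" using gp \<open>\<not> u x y t \<le> 0\<close> by (simp add: w_def e_def)
  note wj = C21_jet_diff_scaled[OF uj gj, of e, folded w_def]
  obtain K where K: "compact K" "K \<subseteq> half_plane"
    "\<And>x y t. (x, y) \<in> half_plane - K \<Longrightarrow> t \<in> {t0<..t1} \<Longrightarrow> w x y t \<le> 0"
    using growth[OF e] by (auto simp: w_def)
  have w0: "w x y t0 \<le> 0" if "0 < y" for x y
  proof -
    have "0 < e * g x y t0" using gpos[OF that, of t0 x] e pt by auto
    then show ?thesis using init[OF that, of x] by (simp add: w_def)
  qed
  have wc: "continuous_on (K \<times> {t0..t1}) (\<lambda>((x, y), t). w x y t)"
  proof -
    have "continuous_on (half_plane \<times> {t0..t1}) (\<lambda>((x, y), t). w x y t)"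
      using uc gc unfolding cont_on_cylinder_def w_def split_beta by (intro continuous_intros)
    then show ?thesis by (rule continuous_on_subset) (use K in auto)
  qed
  \<comment> \<open>All positive values of \<open>w\<close> lie over \<open>K\<close>, so a positive
    maximum over \<open>K\<close> is a maximum over the whole half-plane.\<close>
  have inK: "(x, y) \<in> K" if "0 < w x y t" "0 < y" "t \<in> {t0..t1}" for x y t
    using K(3)[of x y t] w0[of y x] that by (cases "t = t0") force+
  have "K \<times> {t0..t1} \<noteq> {}" using inK[OF wpos pt] pt by auto
  from continuous_attains_sup[OF compact_Times[OF K(1) compact_Icc] this wc]
  obtain a b s where abs: "(a, b) \<in> K" "s \<in> {t0..t1}"
    and le: "\<And>x y t. (x, y) \<in> K \<Longrightarrow> t \<in> {t0..t1} \<Longrightarrow> w x y t \<le> w a b s"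
    by fastforce
  have wm: "0 < w a b s" using le[OF inK[OF wpos pt] pt(2)] wpos by linarith
  have b: "0 < b" using abs K by auto
  have max: "w x y t \<le> w a b s" if "0 < y" "t \<in> {t0..t1}" for x y t
    using le[OF inK] that wm by (cases "0 < w x y t") force+
  have s: "s \<in> {t0<..t1}"
    using w0[OF b, of a] abs(2) wm by (cases "s = t0") auto
  note D = C21_jetD[OF wj] and Du = C21_jetD[OF uj] and Dg = C21_jetD[OF gj]
  \<comment> \<open>The maximum may occur at \<open>s = t1\<close>, hence the one-sided test in
    time.\<close>
  have "0 \<le> ut a b s - e * gt a b s"
    by (rule derivative_nonneg_at_left_max[where s = t0, OF D(1)]) (use b s max in auto)
  then have wt: "e * gt a b s \<le> ut a b s" by simp
  have wx: "ux a b s - e * gx a b s = 0"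
    by (rule DERIV_local_max[OF D(2), of _ _ 1]) (use b s max in auto)
  have wy: "uy a b s - e * gy a b s = 0"
    by (rule DERIV_local_max[OF D(3), of _ _ b]) (use b s max in auto)
  have hess: "c\<^sup>2 * (uxx a b s - e * gxx a b s) + 2 * c * d * (uxy a b s - e * gxy a b s)
      + d\<^sup>2 * (uyy a b s - e * gyy a b s) \<le> 0" for c d
    by (rule second_directional_derivative_nonpos[where S = half_plane and ?x0.0 = a and ?y0.0 = b
          and f = "\<lambda>x y. w x y s" and fx = "\<lambda>x y. ux x y s - e * gx x y s"
          and fy = "\<lambda>x y. uy x y s - e * gy x y s" and fxx = "\<lambda>x y. uxx x y s - e * gxx x y s"
          and fyy = "\<lambda>x y. uyy x y s - e * gyy x y s"])
       (use open_half_plane b s max wx wy in \<open>auto intro: D\<close>)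
  \<comment> \<open>Ellipticity: the second-order part is the quadratic form in direction
    \<open>(\<rho>, 1)\<close> plus \<open>1 - \<rho>\<^sup>2\<close> times the one in direction
    \<open>(1, 0)\<close>, and both are nonpositive.\<close>
  have h1: "uxx a b s - e * gxx a b s \<le> 0" using hess[of 1 0] by simp
  have h2: "\<rho>\<^sup>2 * (uxx a b s - e * gxx a b s) + 2 * \<rho> * (uxy a b s - e * gxy a b s)
      + (uyy a b s - e * gyy a b s) \<le> 0" using hess[of \<rho> 1] by simp
  have "0 \<le> 1 - \<rho>\<^sup>2" using \<rho> by (simp add: abs_square_le_1)
  then have "(1 - \<rho>\<^sup>2) * (uxx a b s - e * gxx a b s) \<le> 0" using h1 by (simp add: mult_nonneg_nonpos)
  with h2 have "(uxx a b s - e * gxx a b s) + 2 * \<rho> * (uxy a b s - e * gxy a b s)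
      + (uyy a b s - e * gyy a b s) \<le> 0"
    by (simp add: algebra_simps)
  then have h: "0 \<le> - (1/2) * \<sigma> * b * ((uxx a b s - e * gxx a b s) + 2 * \<rho> * (uxy a b s - e * gxy a b s)
      + (uyy a b s - e * gyy a b s))"
    using \<sigma> b by (simp add: mult_nonneg_nonpos)
  have ex: "ux a b s = e * gx a b s" "uy a b s = e * gy a b s" using wx wy by auto
  have "e * gt a b s + e * heston_expr \<sigma> \<rho> q \<kappa> \<theta> b (gx a b s) (gy a b s) (gxx a b s) (gxy a b s) (gyy a b s)
    \<le> ut a b s + heston_expr \<sigma> \<rho> q \<kappa> \<theta> b (ux a b s) (uy a b s) (uxx a b s) (uxy a b s) (uyy a b s)"
    using wt h unfolding heston_expr_def ex by (simp add: algebra_simps)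
  also have "\<dots> \<le> 0" by (rule sub[OF b s])
  finally have "e * (gt a b s + heston_expr \<sigma> \<rho> q \<kappa> \<theta> b (gx a b s) (gy a b s) (gxx a b s) (gxy a b s) (gyy a b s)) \<le> 0"
    by (simp add: distrib_left)
  then show False using mult_pos_pos[OF e super[OF b s, of a]] by linarith
qed

section \<open>The barrier: derivatives, residual and growth\<close>

text \<open>\<open>p\<close> and \<open>h\<close> are the logarithmic derivatives of
  \<open>g\<close> in \<open>x\<close> and \<open>y\<close>, and \<open>r\<close> is the derivative
  of \<open>p\<close>. Thus every derivative is a multiple of \<open>g\<close>; the mixed one is
  simply \<open>p * h * g\<close> because \<open>ln g\<close> splits into a function of
  \<open>x\<close> and a function of \<open>(y, t)\<close>.\<close>

lemma barrier_jet:
  fixes b \<gamma> m K \<omega> t0 :: real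
  defines "g \<equiv> \<lambda>x y t. y powr (- b) * exp (\<gamma> * sqrt (1 + x\<^sup>2) + (m + K * (t - t0)) * y + \<omega> * (t - t0))"
    and "p \<equiv> \<lambda>x. \<gamma> * x / sqrt (1 + x\<^sup>2)"
    and "r \<equiv> \<lambda>x. \<gamma> / (sqrt (1 + x\<^sup>2) * (1 + x\<^sup>2))"
    and "h \<equiv> \<lambda>y t. m + K * (t - t0) - b / y"
  shows "C21_jet I g (\<lambda>x y t. (K * y + \<omega>) * g x y t) (\<lambda>x y t. p x * g x y t)
    (\<lambda>x y t. h y t * g x y t) (\<lambda>x y t. (r x + (p x)\<^sup>2) * g x y t)
    (\<lambda>x y t. p x * (h y t * g x y t)) (\<lambda>x y t. (b / y\<^sup>2 + (h y t)\<^sup>2) * g x y t)"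
proof -
  have nz: "sqrt (1 + x\<^sup>2) > 0" "1 + x\<^sup>2 > 0" "1 + x\<^sup>2 \<noteq> 0" for x :: real
    by (auto simp: add_pos_nonneg) (metis add_pos_nonneg less_numeral_extra(1) less_numeral_extra(3) zero_le_power2)
  have gt: "((\<lambda>s. g x y s) has_real_derivative (K * y + \<omega>) * g x y t) (at t)" for x y t
    unfolding g_def by (auto intro!: derivative_eq_intros simp: algebra_simps)
  have gx: "((\<lambda>z. g z y t) has_real_derivative p x * g x y t) (at x)" for x y t
    unfolding g_def p_def using nz[of x]
    by (auto intro!: derivative_eq_intros simp: field_simps)
  have gy: "((\<lambda>z. g x z t) has_real_derivative h y t * g x y t) (at y)" if "0 < y" for x y t
    unfolding g_def h_def using that
    by (auto intro!: derivative_eq_intros simp: field_simps powr_diff)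
  have px: "(p has_real_derivative r x) (at x)" for x
  proof -
    have "sqrt (1 + x * x) * sqrt (1 + x * x) = 1 + x * x" using nz[of x] by (simp add: power2_eq_square)
    then have "\<gamma> * sqrt (1 + x * x) * sqrt (1 + x * x) - \<gamma> * x * x = \<gamma>" by algebra
    then show ?thesis unfolding p_def r_def using nz[of x]
      by (auto intro!: derivative_eq_intros simp: divide_simps power2_eq_square)
  qed
  have hy: "((\<lambda>z. h z t) has_real_derivative b / y\<^sup>2) (at y)" if "0 < y" for y t
    unfolding h_def using that
    by (auto intro!: derivative_eq_intros simp: power2_eq_square)
  have gxx: "((\<lambda>z. p z * g z y t) has_real_derivative (r x + (p x)\<^sup>2) * g x y t) (at x)" for x y t
    by (rule DERIV_cong[OF DERIV_mult[OF px gx]]) (simp add: algebra_simps power2_eq_square)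
  have gyy: "((\<lambda>z. h z t * g x z t) has_real_derivative (b / y\<^sup>2 + (h y t)\<^sup>2) * g x y t) (at y)"
    if "0 < y" for x y t
    by (rule DERIV_cong[OF DERIV_mult[OF hy[OF that] gy[OF that]]]) (simp add: algebra_simps power2_eq_square)
  have cont: "continuous_on half_plane (\<lambda>(x, y). (r x + (p x)\<^sup>2) * g x y t)"
    "continuous_on half_plane (\<lambda>(x, y). (b / y\<^sup>2 + (h y t)\<^sup>2) * g x y t)" for t
    unfolding split_beta r_def p_def h_def g_def using nz
    by (auto intro!: continuous_intros simp: half_plane_def)
  show ?thesis
    unfolding C21_jet_def
    by (intro conjI allI impI ballI gt gx gy gxx gyy cont DERIV_cmult)
qed

text \<open>This is the residual divided by \<open>g\<close>, with \<open>\<mu>\<close> standing for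
  the time-dependent coefficient of \<open>y\<close>. The constants \<open>K\<close> and
  \<open>\<omega>\<close> involve only the bound \<open>M\<close>, so they can be fixed before the
  range of \<open>\<mu>\<close> is known to stay below \<open>M\<close>.\<close>

lemma barrier_residual_pos:
  fixes \<sigma> \<rho> q \<kappa> \<theta> b \<gamma> M y p r \<mu> :: real
  assumes "0 < \<sigma>" "\<bar>\<rho>\<bar> \<le> 1" "0 < \<kappa>" "0 < \<theta>" "0 < b" "b + 1 \<le> 2 * \<kappa> * \<theta> / \<sigma>\<^sup>2"
    and y: "0 < y" and p: "\<bar>p\<bar> \<le> \<gamma>" and r: "r \<le> \<gamma>" and \<mu>: "0 \<le> \<mu>" "\<mu> \<le> M"
  defines "K \<equiv> \<sigma> / 2 * (2 * \<gamma> + \<gamma>\<^sup>2 + 2 * \<gamma> * M + M\<^sup>2)"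
    and "\<omega> \<equiv> 1 + \<sigma> * \<gamma> * b + \<bar>q\<bar> * \<gamma> + \<kappa> * b + \<kappa> * \<theta> * M / \<sigma>"
    and "h \<equiv> \<mu> - b / y"
  shows "0 < (K * y + \<omega>) + heston_expr \<sigma> \<rho> q \<kappa> \<theta> y p h (r + p\<^sup>2) (p * h) (b / y\<^sup>2 + h\<^sup>2)"
proof -
  have \<gamma>: "0 \<le> \<gamma>" using p by linarith
  \<comment> \<open>The residual is sorted by the powers \<open>1 / y\<close>, \<open>y\<close> and
    1. The first two coefficients are shown nonnegative; the summand 1 in \<open>\<omega>\<close>
    makes the third positive.\<close>
  have id: "(K * y + \<omega>) + heston_expr \<sigma> \<rho> q \<kappa> \<theta> y p h (r + p\<^sup>2) (p * h) (b / y\<^sup>2 + h\<^sup>2)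
     = b * (\<kappa> * \<theta> / \<sigma> - \<sigma> / 2 * (b + 1)) / y
       + y * (K - \<sigma> / 2 * (r + p\<^sup>2 + 2 * (\<rho> * p) * \<mu> + \<mu>\<^sup>2) + \<sigma> / 2 * p + \<kappa> * \<mu>)
       + (\<omega> + \<sigma> * (\<rho> * p) * b + \<sigma> * b * \<mu> + q * p - \<kappa> * b - \<kappa> * \<theta> * \<mu> / \<sigma>)"
    using y \<open>0 < \<sigma>\<close> unfolding heston_expr_def h_def
    by (simp add: field_simps power2_eq_square)
  have rp: "\<bar>\<rho> * p\<bar> \<le> \<gamma>"
    using mult_mono[OF assms(2) p] by (simp add: abs_mult)
  have "\<sigma>\<^sup>2 * (b + 1) \<le> 2 * \<kappa> * \<theta>" using assms(1,6) by (simp add: field_simps)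
  then have "0 \<le> \<kappa> * \<theta> / \<sigma> - \<sigma> / 2 * (b + 1)" using assms(1) by (simp add: field_simps power2_eq_square)
  then have 1: "0 \<le> b * (\<kappa> * \<theta> / \<sigma> - \<sigma> / 2 * (b + 1)) / y" using assms y by simp
  have p2: "p\<^sup>2 \<le> \<gamma>\<^sup>2" using p \<gamma> by (metis abs_le_square_iff abs_of_nonneg)
  have m2: "\<mu>\<^sup>2 \<le> M\<^sup>2" using \<mu> by (simp add: power_mono)
  have pm: "\<rho> * p * \<mu> \<le> \<gamma> * M" using rp \<mu> \<gamma>
    by (meson abs_ge_self mult_mono order_trans)
  have "r + p\<^sup>2 + 2 * (\<rho> * p) * \<mu> + \<mu>\<^sup>2 - p \<le> 2 * \<gamma> + \<gamma>\<^sup>2 + 2 * \<gamma> * M + M\<^sup>2"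
    using p2 m2 pm r p by linarith
  then have "\<sigma> / 2 * (r + p\<^sup>2 + 2 * (\<rho> * p) * \<mu> + \<mu>\<^sup>2 - p) \<le> K"
    unfolding K_def using assms(1) by (intro mult_left_mono) auto
  moreover have "0 \<le> \<kappa> * \<mu>" using assms by simp
  ultimately have "0 \<le> K - \<sigma> / 2 * (r + p\<^sup>2 + 2 * (\<rho> * p) * \<mu> + \<mu>\<^sup>2) + \<sigma> / 2 * p + \<kappa> * \<mu>"
    by (simp add: algebra_simps)
  then have 2: "0 \<le> y * (K - \<sigma> / 2 * (r + p\<^sup>2 + 2 * (\<rho> * p) * \<mu> + \<mu>\<^sup>2) + \<sigma> / 2 * p + \<kappa> * \<mu>)"
    using y by simp
  have "- (\<sigma> * \<gamma> * b) \<le> \<sigma> * (\<rho> * p) * b"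
    using mult_left_mono[of "- \<gamma>" "\<rho> * p" "\<sigma> * b"] rp assms by (simp add: algebra_simps)
  moreover have "- (\<bar>q\<bar> * \<gamma>) \<le> q * p"
    using mult_left_mono[OF p, of "\<bar>q\<bar>"] abs_ge_minus_self[of "q * p"] by (simp add: abs_mult)
  moreover have "\<kappa> * \<theta> * \<mu> / \<sigma> \<le> \<kappa> * \<theta> * M / \<sigma>"
    using assms by (intro divide_right_mono mult_left_mono) auto
  moreover have "0 \<le> \<sigma> * b * \<mu>" using assms by simp
  ultimately have 3: "0 < \<omega> + \<sigma> * (\<rho> * p) * b + \<sigma> * b * \<mu> + q * p - \<kappa> * b - \<kappa> * \<theta> * \<mu> / \<sigma>"
    unfolding \<omega>_def by linarith
  show ?thesis unfolding id using 1 2 3 by linarith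
qed

text \<open>The extra factor \<open>exp (- (d + 1) * y)\<close> absorbs \<open>y powr d\<close>, because \<open>y \<le> exp y\<close>.\<close>

lemma majorant_le_barrier_outside_compact:
  fixes \<beta> \<gamma> \<mu> d \<delta> :: real
  assumes "0 < d" "0 < \<delta>"
  obtains K where "compact K" "K \<subseteq> half_plane"
    "\<And>x y. (x, y) \<in> half_plane - K \<Longrightarrow> majorant \<beta> \<gamma> \<mu> x y
       \<le> \<delta> * (y powr (- (\<beta> - 1 + d)) * exp ((\<gamma> + 1) * sqrt (1 + x\<^sup>2) + (\<mu> + d + 1) * y))"
proof -
  \<comment> \<open>These choices give \<open>exp (- R) = \<delta>\<close> and
    \<open>a powr d = \<delta>\<close>. For \<open>\<delta> \<ge> 1\<close> the box below is empty,
    which does no harm.\<close>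
  define R where "R = - ln \<delta>"
  define a where "a = \<delta> powr (1 / d)"
  have a: "0 < a" using assms by (simp add: a_def)
  show thesis
  proof (rule that[of "{-R..R} \<times> {a..R}"])
    show "compact ({-R..R} \<times> {a..R})" by (intro compact_Times compact_Icc)
    show "{-R..R} \<times> {a..R} \<subseteq> half_plane" using a by (auto simp: half_plane_def)
    fix x y :: real
    assume xy: "(x, y) \<in> half_plane - {-R..R} \<times> {a..R}"
    then have y: "0 < y" by simp
    \<comment> \<open>\<open>E\<close> is the quotient of the majorant by the barrier. It is bounded
      by \<open>exp (- y)\<close>, \<open>exp (- \<bar>x\<bar>)\<close> and \<open>y powr d\<close>,
      one bound for each way of leaving the box.\<close>
    define E where "E = y powr d * exp (- (d + 1) * y) * exp (- sqrt (1 + x\<^sup>2))"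
    have s: "\<bar>x\<bar> \<le> sqrt (1 + x\<^sup>2)" by (rule real_le_rsqrt) simp
    have "y powr d \<le> exp y powr d"
      using y assms ln_less_self[of y] by (intro powr_mono2) (auto intro: order_trans[OF _ exp_ge_add_one_self[of y]])
    then have "y powr d \<le> exp (d * y)" by (simp add: powr_def mult.commute)
    then have "y powr d * exp (- (d + 1) * y) \<le> exp (d * y) * exp (- (d + 1) * y)"
      by (intro mult_right_mono) auto
    also have "\<dots> = exp (- y)" by (simp add: exp_add[symmetric] algebra_simps)
    finally have 1: "y powr d * exp (- (d + 1) * y) \<le> exp (- y)" .
    have le1: "y powr d * exp (- (d + 1) * y) \<le> 1" by (rule order_trans[OF 1]) (use y in simp)
    have dy: "(- d - 1) * y \<le> 0" using assms y by (simp add: mult_nonpos_nonneg)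
    have e1: "exp (- sqrt (1 + x\<^sup>2)) \<le> 1" "exp (- sqrt (1 + x\<^sup>2)) \<le> exp (- \<bar>x\<bar>)" using s by auto
    have "E \<le> exp (- y) * 1" unfolding E_def using 1 e1 by (intro mult_mono) auto
    moreover have "E \<le> 1 * exp (- \<bar>x\<bar>)" unfolding E_def using le1 e1
      by (intro mult_mono) auto
    moreover have "E \<le> y powr d * 1 * 1" unfolding E_def using e1 dy
      by (intro mult_mono) (auto simp: mult_nonneg_nonneg)
    moreover have "exp (- y) \<le> \<delta>" if "R < y"
    proof -
      have "exp (- y) \<le> exp (ln \<delta>)" using that by (simp add: R_def)
      then show ?thesis using assms by simp
    qed
    moreover have "exp (- \<bar>x\<bar>) \<le> \<delta>" if "R < \<bar>x\<bar>"
    proof -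
      have "exp (- \<bar>x\<bar>) \<le> exp (ln \<delta>)" using that by (simp add: R_def)
      then show ?thesis using assms by simp
    qed
    moreover have "y powr d \<le> \<delta>" if "y < a"
    proof -
      have "y powr d \<le> a powr d" using that y assms by (intro powr_mono2) auto
      then show ?thesis using assms by (simp add: a_def powr_powr)
    qed
    moreover have "R < y \<or> R < \<bar>x\<bar> \<or> y < a" using xy by auto
    ultimately have E: "E \<le> \<delta>" by fastforce
    let ?g = "y powr (- (\<beta> - 1 + d)) * exp ((\<gamma> + 1) * sqrt (1 + x\<^sup>2) + (\<mu> + d + 1) * y)"
    have "majorant \<beta> \<gamma> \<mu> x y = E * ?g"
    proof -
      have "E * ?g = (y powr d * y powr (- (\<beta> - 1 + d))) * (exp (- (d + 1) * y) * exp (- sqrt (1 + x\<^sup>2)) *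
         exp ((\<gamma> + 1) * sqrt (1 + x\<^sup>2) + (\<mu> + d + 1) * y))"
        unfolding E_def by (simp only: mult_ac)
      also have "y powr d * y powr (- (\<beta> - 1 + d)) = y powr (- (\<beta> - 1))"
        by (simp add: powr_add[symmetric])
      also have "exp (- (d + 1) * y) * exp (- sqrt (1 + x\<^sup>2)) * exp ((\<gamma> + 1) * sqrt (1 + x\<^sup>2) + (\<mu> + d + 1) * y)
        = exp (\<gamma> * sqrt (1 + x\<^sup>2) + \<mu> * y)"
        unfolding exp_add[symmetric] by (simp add: algebra_simps)
      finally show ?thesis by (simp add: majorant_def)
    qed
    also have "\<dots> \<le> \<delta> * ?g" using E by (intro mult_right_mono) auto
    finally show "majorant \<beta> \<gamma> \<mu> x y \<le> \<delta> * ?g" .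
  qed
qed

section \<open>The maximum principle for short times and its iteration\<close>

text \<open>The order of quantifiers is the point: \<open>\<tau>\<close> depends on the parameters
  alone, not on \<open>u\<close>, \<open>C\<close> or the starting time \<open>t0\<close>, so steps
  of this length can be repeated.\<close>

lemma short_time_nonpos:
  fixes \<sigma> \<rho> q \<kappa> \<theta> \<beta> \<gamma> \<mu> :: real
  assumes "0 < \<sigma>" "\<bar>\<rho>\<bar> \<le> 1" "0 < \<kappa>" "0 < \<theta>" "0 < \<gamma>" "0 < \<mu>" "1 \<le> \<beta>"
    and \<beta>: "\<beta> < 2 * \<kappa> * \<theta> / \<sigma>\<^sup>2"
  obtains \<tau> where "0 < \<tau>"
    "\<And>u ut ux uy uxx uxy uyy t0 t1 C x y t.
      \<lbrakk>C21_jet {t0<..t1} u ut ux uy uxx uxy uyy; cont_on_cylinder {t0..t1} u; t1 \<le> t0 + \<tau>; 0 < C;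
       \<And>x y t. 0 < y \<Longrightarrow> t \<in> {t0<..t1} \<Longrightarrow>
         ut x y t + heston_expr \<sigma> \<rho> q \<kappa> \<theta> y (ux x y t) (uy x y t) (uxx x y t) (uxy x y t) (uyy x y t) \<le> 0;
       \<And>x y t. 0 < y \<Longrightarrow> t \<in> {t0<..t1} \<Longrightarrow> u x y t \<le> C * majorant \<beta> \<gamma> \<mu> x y;
       \<And>x y. 0 < y \<Longrightarrow> u x y t0 \<le> 0; 0 < y; t \<in> {t0..t1}\<rbrakk> \<Longrightarrow> u x y t \<le> 0"
proof -
  \<comment> \<open>Half of the gap between \<open>\<beta>\<close> and its upper bound. Then
    \<open>b\<close> exceeds the exponent \<open>\<beta> - 1\<close> of the majorant, while
    \<open>b + 1 = \<beta> + d\<close> remains below the bound.\<close>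
  define d where "d = (2 * \<kappa> * \<theta> / \<sigma>\<^sup>2 - \<beta>) / 2"
  define b where "b = \<beta> - 1 + d"
  define m where "m = \<mu> + d + 1"
  \<comment> \<open>\<open>K\<close> and \<open>\<omega>\<close> are the constants of
    \<open>barrier_residual_pos\<close> for \<open>\<gamma> + 1\<close> and
    \<open>M = m + 1\<close>.\<close>
  define K where "K = \<sigma> / 2 * (2 * (\<gamma> + 1) + (\<gamma> + 1)\<^sup>2 + 2 * (\<gamma> + 1) * (m + 1) + (m + 1)\<^sup>2)"
  define \<omega> where "\<omega> = 1 + \<sigma> * (\<gamma> + 1) * b + \<bar>q\<bar> * (\<gamma> + 1) + \<kappa> * b + \<kappa> * \<theta> * (m + 1) / \<sigma>"
  have d: "0 < d" using \<beta> by (simp add: d_def)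
  have b: "0 < b" "b + 1 \<le> 2 * \<kappa> * \<theta> / \<sigma>\<^sup>2"
  proof -
    show "0 < b" using d assms by (simp add: b_def)
    have "\<beta> + 2 * ((c - \<beta>) / 2) = c" for c by (simp add: field_simps)
    from this[of "2 * \<kappa> * \<theta> / \<sigma>\<^sup>2", folded d_def]
    have "\<beta> + 2 * d = 2 * \<kappa> * \<theta> / \<sigma>\<^sup>2" .
    then show "b + 1 \<le> 2 * \<kappa> * \<theta> / \<sigma>\<^sup>2" using d by (simp add: b_def)
  qed
  have m: "0 < m" using d assms by (simp add: m_def)
  have K: "0 < K" unfolding K_def using m assms by (intro mult_pos_pos add_pos_nonneg) auto
  have \<omega>: "0 < \<omega>" unfolding \<omega>_def using m assms b by (intro add_pos_nonneg) auto
  show thesis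
  \<comment> \<open>Over a time \<open>1 / K\<close> the coefficient \<open>m + K * (t - t0)\<close>
    grows by at most 1 and so respects the bound \<open>m + 1\<close> from which \<open>K\<close>
    was built.\<close>
  proof (rule that[of "1 / K"])
    show "0 < 1 / K" using K by simp
    fix u ut ux uy uxx uxy uyy :: "real \<Rightarrow> real \<Rightarrow> real \<Rightarrow> real" and t0 t1 C x y t :: real
    assume uj: "C21_jet {t0<..t1} u ut ux uy uxx uxy uyy" and uc: "cont_on_cylinder {t0..t1} u"
      and t1: "t1 \<le> t0 + 1 / K" and C: "0 < C"
      and sub: "\<And>x y t. 0 < y \<Longrightarrow> t \<in> {t0<..t1} \<Longrightarrow>
         ut x y t + heston_expr \<sigma> \<rho> q \<kappa> \<theta> y (ux x y t) (uy x y t) (uxx x y t) (uxy x y t) (uyy x y t) \<le> 0"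
      and maj: "\<And>x y t. 0 < y \<Longrightarrow> t \<in> {t0<..t1} \<Longrightarrow> u x y t \<le> C * majorant \<beta> \<gamma> \<mu> x y"
      and init: "\<And>x y. 0 < y \<Longrightarrow> u x y t0 \<le> 0" and pt: "0 < y" "t \<in> {t0..t1}"
    define g where "g = (\<lambda>x y t. y powr (- b) * exp ((\<gamma> + 1) * sqrt (1 + x\<^sup>2) + (m + K * (t - t0)) * y + \<omega> * (t - t0)))"
    define p where "p = (\<lambda>x. (\<gamma> + 1) * x / sqrt (1 + x\<^sup>2))"
    define r where "r = (\<lambda>x::real. (\<gamma> + 1) / (sqrt (1 + x\<^sup>2) * (1 + x\<^sup>2)))"
    define h where "h = (\<lambda>y t. m + K * (t - t0) - b / y)"
    have gj: "C21_jet {t0<..t1} g (\<lambda>x y t. (K * y + \<omega>) * g x y t) (\<lambda>x y t. p x * g x y t)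
        (\<lambda>x y t. h y t * g x y t) (\<lambda>x y t. (r x + (p x)\<^sup>2) * g x y t)
        (\<lambda>x y t. p x * (h y t * g x y t)) (\<lambda>x y t. (b / y\<^sup>2 + (h y t)\<^sup>2) * g x y t)"
      unfolding g_def p_def r_def h_def by (rule barrier_jet)
    have gpos: "0 < g x y t" if "0 < y" for x y t using that by (simp add: g_def)
    have p: "\<bar>p x\<bar> \<le> \<gamma> + 1" for x
    proof -
      have "\<bar>x\<bar> \<le> sqrt (1 + x\<^sup>2)" by (rule real_le_rsqrt) simp
      moreover have "0 < sqrt (1 + x\<^sup>2)" by (simp add: add_pos_nonneg)
      ultimately have "\<bar>x\<bar> / sqrt (1 + x\<^sup>2) \<le> 1" by (simp only: divide_le_eq_1_pos)
      then have "(\<gamma> + 1) * (\<bar>x\<bar> / sqrt (1 + x\<^sup>2)) \<le> (\<gamma> + 1) * 1" using assms by (intro mult_left_mono) auto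
      then show ?thesis using assms by (simp add: p_def abs_mult)
    qed
    have r: "r x \<le> \<gamma> + 1" for x
    proof -
      have "1 * 1 \<le> sqrt (1 + x\<^sup>2) * (1 + x\<^sup>2)" by (intro mult_mono) auto
      then have "(\<gamma> + 1) / (sqrt (1 + x\<^sup>2) * (1 + x\<^sup>2)) \<le> (\<gamma> + 1) / 1"
        using assms by (intro divide_left_mono) auto
      then show ?thesis by (simp add: r_def)
    qed
    show "u x y t \<le> 0"
    proof (rule comparison_with_barrier[OF assms(1,2) uj gj uc _ _ sub _ init _ pt])
      show "cont_on_cylinder {t0..t1} g"
        unfolding cont_on_cylinder_def g_def split_beta
        by (auto intro!: continuous_intros simp: half_plane_def)
      show "0 < g x y t" if "0 < y" for x y t by (rule gpos[OF that])
      show "0 < (K * y + \<omega>) * g x y t + heston_expr \<sigma> \<rho> q \<kappa> \<theta> y (p x * g x y t) (h y t * g x y t)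
          ((r x + (p x)\<^sup>2) * g x y t) (p x * (h y t * g x y t)) ((b / y\<^sup>2 + (h y t)\<^sup>2) * g x y t)"
        if "0 < y" "t \<in> {t0<..t1}" for x y t
      proof -
        have "K * (t - t0) \<le> K * (1 / K)" using t1 that K by (intro mult_left_mono) auto
        then have "0 \<le> m + K * (t - t0)" "m + K * (t - t0) \<le> m + 1"
          using that m K by auto
        note res = barrier_residual_pos[OF assms(1-4) b that(1) p r this, of q x x,
            folded K_def \<omega>_def]
        have "0 < g x y t * ((K * y + \<omega>) + heston_expr \<sigma> \<rho> q \<kappa> \<theta> y (p x) (h y t)
            (r x + (p x)\<^sup>2) (p x * h y t) (b / y\<^sup>2 + (h y t)\<^sup>2))"
          using gpos[OF that(1), of x t] res unfolding h_def by (rule mult_pos_pos)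
        then show ?thesis by (simp add: heston_expr_def algebra_simps)
      qed
      fix e :: real assume e: "0 < e"
      from C e have "0 < e / C" by simp
      from majorant_le_barrier_outside_compact[OF d this, of \<beta> \<gamma> \<mu>]
      obtain S where S: "compact S" "S \<subseteq> half_plane"
        "\<And>x y. (x, y) \<in> half_plane - S \<Longrightarrow> majorant \<beta> \<gamma> \<mu> x y
           \<le> e / C * (y powr (- b) * exp ((\<gamma> + 1) * sqrt (1 + x\<^sup>2) + m * y))"
        unfolding b_def m_def by blast
      have "u x y t \<le> e * g x y t" if xy: "(x, y) \<in> half_plane - S" and t: "t \<in> {t0<..t1}" for x y t
      proof -
        have y: "0 < y" using xy by simp
        have "u x y t \<le> C * majorant \<beta> \<gamma> \<mu> x y" by (rule maj[OF y t])
        also have "\<dots> \<le> C * (e / C * (y powr (- b) * exp ((\<gamma> + 1) * sqrt (1 + x\<^sup>2) + m * y)))"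
          using S(3)[OF xy] C by (intro mult_left_mono) auto
        also have "\<dots> = e * (y powr (- b) * exp ((\<gamma> + 1) * sqrt (1 + x\<^sup>2) + m * y))" using C by simp
        \<comment> \<open>The barrier increases in time, so dominating the majorant at
          \<open>t0\<close> suffices.\<close>
        also have "\<dots> \<le> e * g x y t"
          unfolding g_def using e t y K \<omega> by (intro mult_left_mono) (auto simp: distrib_right)
        finally show ?thesis .
      qed
      then show "\<exists>S. compact S \<and> S \<subseteq> half_plane \<and>
          (\<forall>x y t. (x, y) \<in> half_plane - S \<longrightarrow> t \<in> {t0<..t1} \<longrightarrow> u x y t \<le> e * g x y t)"
        using S(1,2) by blast
    qed
  qed
qed

lemma cont_on_cylinder_subset: "cont_on_cylinder I u \<Longrightarrow> J \<subseteq> I \<Longrightarrow> cont_on_cylinder J u"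
  unfolding cont_on_cylinder_def by (erule continuous_on_subset) auto

lemma heston_maximum_principle:
  fixes \<sigma> \<rho> q \<kappa> \<theta> \<beta> \<gamma> \<mu> :: real
  assumes params: "0 < \<sigma>" "\<bar>\<rho>\<bar> \<le> 1" "0 < \<kappa>" "0 < \<theta>" "0 < \<gamma>" "0 < \<mu>" "1 \<le> \<beta>" "\<beta> < 2 * \<kappa> * \<theta> / \<sigma>\<^sup>2"
    and uj: "C21_jet {0<..t1} u ut ux uy uxx uxy uyy" and uc: "cont_on_cylinder {0..t1} u"
    and C: "0 < C"
    and sub: "\<And>x y t. 0 < y \<Longrightarrow> t \<in> {0<..t1} \<Longrightarrow>
      ut x y t + heston_expr \<sigma> \<rho> q \<kappa> \<theta> y (ux x y t) (uy x y t) (uxx x y t) (uxy x y t) (uyy x y t) \<le> 0"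
    and maj: "\<And>x y t. 0 < y \<Longrightarrow> t \<in> {0<..t1} \<Longrightarrow> u x y t \<le> C * majorant \<beta> \<gamma> \<mu> x y"
    and init: "\<And>x y. 0 < y \<Longrightarrow> u x y 0 \<le> 0"
    and pt: "0 < y" "t \<in> {0..t1}"
  shows "u x y t \<le> 0"
proof -
  obtain \<tau> where \<tau>: "0 < \<tau>" and step:
    "\<And>u ut ux uy uxx uxy uyy t0 t1 C x y t.
      \<lbrakk>C21_jet {t0<..t1} u ut ux uy uxx uxy uyy; cont_on_cylinder {t0..t1} u; t1 \<le> t0 + \<tau>; 0 < C;
       \<And>x y t. 0 < y \<Longrightarrow> t \<in> {t0<..t1} \<Longrightarrow>
         ut x y t + heston_expr \<sigma> \<rho> q \<kappa> \<theta> y (ux x y t) (uy x y t) (uxx x y t) (uxy x y t) (uyy x y t) \<le> 0;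
       \<And>x y t. 0 < y \<Longrightarrow> t \<in> {t0<..t1} \<Longrightarrow> u x y t \<le> C * majorant \<beta> \<gamma> \<mu> x y;
       \<And>x y. 0 < y \<Longrightarrow> u x y t0 \<le> 0; 0 < y; t \<in> {t0..t1}\<rbrakk> \<Longrightarrow> u x y t \<le> 0"
    by (rule short_time_nonpos[OF params]) blast
  \<comment> \<open>Each step supplies the sign at time \<open>n * \<tau>\<close>, which is the
    initial condition of the next one.\<close>
  have key: "u x y t \<le> 0" if "0 < y" "t \<in> {0..t1}" "t \<le> real n * \<tau>" for n x y t
    using that
  proof (induction n arbitrary: x y t)
    case 0
    then show ?case using init by simp
  next
    case (Suc n)
    show ?case
    proof (cases "t \<le> real n * \<tau>")
      case True
      with Suc show ?thesis by blast
    next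
      case False
      have n0: "0 \<le> real n * \<tau>" using \<tau> by simp
      show ?thesis
      \<comment> \<open>The next interval runs from \<open>n * \<tau>\<close> to \<open>t\<close>
        itself, so it does not pass \<open>t1\<close>.\<close>
      proof (rule step[OF C21_jet_subset[OF uj] cont_on_cylinder_subset[OF uc] _ C sub maj])
        show "u x y (real n * \<tau>) \<le> 0" if "0 < y" for x y
          using Suc.IH[OF that, of "real n * \<tau>"] Suc.prems False n0 by auto
        show "t \<le> real n * \<tau> + \<tau>" using Suc.prems by (simp add: algebra_simps)
      qed (use n0 Suc.prems False in auto)
    qed
  qed
  obtain n where "t < real n * \<tau>" using reals_Archimedean3[OF \<tau>] by blast
  then show ?thesis using key[OF pt] by (meson less_imp_le)
qed

section \<open>Application to \<open>C21\<close> functions and strong solutions\<close>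

lemma C21_imp_jet:
  assumes "C21 T u"
  shows "C21_jet (time_open T) u (D_t u) (\<lambda>x y t. D_x (slice u t) x y) (\<lambda>x y t. D_xi (slice u t) x y)
    (\<lambda>x y t. D_x (D_x (slice u t)) x y) (\<lambda>x y t. D_xi (D_x (slice u t)) x y)
    (\<lambda>x y t. D_xi (D_xi (slice u t)) x y)"
proof -
  have restrict: "continuous_on half_plane (\<lambda>(x, y). v x y t)"
    if "cont_on_cylinder I v" "t \<in> I" for v I t
  proof -
    have "continuous_on half_plane ((\<lambda>((x, y), t). v x y t) \<circ> (\<lambda>z. (z, t)))"
      using that(2)
      by (intro continuous_on_compose continuous_intros continuous_on_subset[OF that(1)[unfolded cont_on_cylinder_def]])
         auto
    then show ?thesis by (simp add: comp_def split_beta)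
  qed
  have eqs: "D_t u x y t = deriv (\<lambda>s. u x y s) t" "D_x (slice u t) x y = deriv (\<lambda>z. u z y t) x"
    "D_xi (slice u t) x y = deriv (\<lambda>z. u x z t) y" for x y t
    by (auto simp: D_t_def D_x_def D_xi_def slice_def)
  have eqs2: "D_x v x y = deriv (\<lambda>z. v z y) x" "D_xi v x y = deriv (\<lambda>z. v x z) y" for v x y
    by (auto simp: D_x_def D_xi_def)
  have D: "((\<lambda>s. u x y s) has_real_derivative D_t u x y t) (at t) \<and>
      ((\<lambda>z. u z y t) has_real_derivative D_x (slice u t) x y) (at x) \<and>
      ((\<lambda>z. u x z t) has_real_derivative D_xi (slice u t) x y) (at y) \<and>
      ((\<lambda>z. D_x (slice u t) z y) has_real_derivative D_x (D_x (slice u t)) x y) (at x) \<and>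
      ((\<lambda>z. D_x (slice u t) x z) has_real_derivative D_xi (D_x (slice u t)) x y) (at y) \<and>
      ((\<lambda>z. D_xi (slice u t) x z) has_real_derivative D_xi (D_xi (slice u t)) x y) (at y)"
    if "0 < y" "t \<in> time_open T" for x y t
  proof -
    have "(x, y) \<in> half_plane" using that by simp
    with assms that(2) show ?thesis
      \<comment> \<open>The equations are instantiated so that only the outer derivatives become
        \<open>deriv\<close>, while the inner \<open>D_x (slice u t)\<close> and
        \<open>D_xi (slice u t)\<close> stay folded.\<close>
      unfolding C21_def eqs(1) eqs(2)[of t x y] eqs(3)[of t x y]
        eqs2(1)[of "D_x (slice u t)"] eqs2(2)[of "D_x (slice u t)"] eqs2(2)[of "D_xi (slice u t)"]
        DERIV_deriv_iff_field_differentiable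
      by fast
  qed
  show ?thesis
    unfolding C21_jet_def using D restrict assms unfolding C21_def by blast
qed

lemma heston_op_eq_expr:
  "heston_op \<sigma> \<rho> q \<kappa> \<theta> v x y = heston_expr \<sigma> \<rho> q \<kappa> \<theta> y (D_x v x y) (D_xi v x y)
     (D_x (D_x v) x y) (D_xi (D_x v) x y) (D_xi (D_xi v) x y)"
  by (simp add: heston_op_def heston_expr_def)

text \<open>The maximum principle is applied with the evaluation time \<open>t\<close> as its
  horizon. As \<open>t\<close> is a real number, this covers infinite \<open>T\<close> as
  well.\<close>

lemma time_open_Ioc_subset: "t \<in> time_halfopen T \<Longrightarrow> {0<..t} \<subseteq> time_open T"
  and time_halfopen_Icc_subset: "t \<in> time_halfopen T \<Longrightarrow> {0..t} \<subseteq> time_halfopen T"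
  and time_open_subset_halfopen: "time_open T \<subseteq> time_halfopen T"
  and time_halfopen_nonneg: "t \<in> time_halfopen T \<Longrightarrow> 0 \<le> t"
  by (auto simp: time_open_def time_halfopen_def; meson ereal_less_eq(3) le_less_trans)+

text \<open>The difference of the solutions solves the homogeneous equation with zero initial
  values, and its growth is controlled with the constant \<open>A + B\<close>.\<close>

lemma heston_solution_le:
  fixes \<sigma> \<rho> q \<kappa> \<theta> \<beta> \<gamma> \<mu> :: real
  assumes params: "0 < \<sigma>" "\<bar>\<rho>\<bar> \<le> 1" "0 < \<kappa>" "0 < \<theta>" "0 < \<gamma>" "0 < \<mu>" "1 \<le> \<beta>" "\<beta> < 2 * \<kappa> * \<theta> / \<sigma>\<^sup>2"
    and u: "heston_strong_solution T \<sigma> \<rho> q \<kappa> \<theta> f u0 u"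
    and v: "heston_strong_solution T \<sigma> \<rho> q \<kappa> \<theta> f u0 v"
    and ub: "0 < A" "\<And>x y t. 0 < y \<Longrightarrow> t \<in> time_halfopen T \<Longrightarrow> \<bar>u x y t\<bar> \<le> A * majorant \<beta> \<gamma> \<mu> x y"
    and vb: "0 < B" "\<And>x y t. 0 < y \<Longrightarrow> t \<in> time_halfopen T \<Longrightarrow> \<bar>v x y t\<bar> \<le> B * majorant \<beta> \<gamma> \<mu> x y"
    and pt: "0 < y" "t \<in> time_halfopen T"
  shows "u x y t \<le> v x y t"
proof -
  note sub1 = time_open_Ioc_subset[OF pt(2)] and sub2 = time_halfopen_Icc_subset[OF pt(2)]
  have C21: "C21 T u" "C21 T v" using u v by (auto simp: heston_strong_solution_def)
  note jet = C21_jet_subset[OF C21_jet_diff_scaled[OF C21_imp_jet[OF C21(1)] C21_imp_jet[OF C21(2)], of 1] sub1]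
  have "u x y t - 1 * v x y t \<le> 0"
  proof (rule heston_maximum_principle[OF params jet, where C = "A + B"])
    have "cont_on_cylinder (time_halfopen T) (\<lambda>x y t. u x y t - 1 * v x y t)"
      using u v unfolding heston_strong_solution_def cont_on_cylinder_def split_beta
      by (intro continuous_intros) auto
    then show "cont_on_cylinder {0..t} (\<lambda>x y t. u x y t - 1 * v x y t)"
      by (rule cont_on_cylinder_subset[OF _ sub2])
    show "0 < A + B" using ub(1) vb(1) by simp
    show "u x y 0 - 1 * v x y 0 \<le> 0" if "0 < y" for x y
    proof -
      have "(x, y) \<in> half_plane" using that by simp
      with u v have "u x y 0 = u0 x y" "v x y 0 = u0 x y"
        unfolding heston_strong_solution_def by blast+
      then show ?thesis by simp
    qed
    show "0 < y" by fact
    show "t \<in> {0..t}" using time_halfopen_nonneg[OF pt(2)] by simp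
  next
    fix x y s :: real assume y: "0 < y" and s: "s \<in> {0<..t}"
    have *: "s \<in> time_open T" "s \<in> time_halfopen T" using s sub1 sub2 by auto
    show "u x y s - 1 * v x y s \<le> (A + B) * majorant \<beta> \<gamma> \<mu> x y"
      using ub(2)[OF y *(2), of x] vb(2)[OF y *(2), of x] by (simp add: distrib_right)
    have "(x, y) \<in> half_plane" using y by simp
    with u v *(1) have
      "D_t u x y s + heston_op \<sigma> \<rho> q \<kappa> \<theta> (slice u s) x y = f x y s"
      "D_t v x y s + heston_op \<sigma> \<rho> q \<kappa> \<theta> (slice v s) x y = f x y s"
      unfolding heston_strong_solution_def by blast+
    then show "D_t u x y s - 1 * D_t v x y s + heston_expr \<sigma> \<rho> q \<kappa> \<theta> y
        (D_x (slice u s) x y - 1 * D_x (slice v s) x y) (D_xi (slice u s) x y - 1 * D_xi (slice v s) x y)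
        (D_x (D_x (slice u s)) x y - 1 * D_x (D_x (slice v s)) x y)
        (D_xi (D_x (slice u s)) x y - 1 * D_xi (D_x (slice v s)) x y)
        (D_xi (D_xi (slice u s)) x y - 1 * D_xi (D_xi (slice v s)) x y) \<le> 0"
      by (simp add: heston_op_eq_expr heston_expr_def algebra_simps)
  qed
  then show ?thesis by simp
qed

theorem theorem4p4:
  fixes T :: ereal and \<sigma> \<rho> q\<^sub>r \<kappa> \<theta> \<beta>\<^sub>0 \<gamma>\<^sub>0 \<mu>\<^sub>0 :: real
  assumes "0 < T"
    and "-1 < \<rho>" and "\<rho> < 1"
    and "0 < \<sigma>" and "0 < \<kappa>" and "0 < \<theta>"
    and feller: "(1/2) * \<sigma>\<^sup>2 - \<kappa> * \<theta> < 0"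
    and "0 < \<gamma>\<^sub>0" and "0 < \<beta>\<^sub>0" and "0 < \<mu>\<^sub>0"
    and "1 \<le> \<beta>\<^sub>0" and "\<beta>\<^sub>0 < 2 * \<kappa> * \<theta> / \<sigma>\<^sup>2"
    and "\<beta>\<^sub>0 - 1 < \<mu>\<^sub>0"
  shows
    "(\<forall>u :: real \<Rightarrow> real \<Rightarrow> real \<Rightarrow> real.
        cont_on_cylinder (time_halfopen T) u \<and> C21 T u \<and>
        (\<forall>(x, \<xi>) \<in> half_plane. \<forall>t \<in> time_open T.
           D_t u x \<xi> t + heston_op \<sigma> \<rho> q\<^sub>r \<kappa> \<theta> (slice u t) x \<xi> \<le> 0) \<and>
        (\<exists>C > 0. \<forall>(x, \<xi>) \<in> half_plane. \<forall>t \<in> time_open T.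
           u x \<xi> t \<le> C * majorant \<beta>\<^sub>0 \<gamma>\<^sub>0 \<mu>\<^sub>0 x \<xi>) \<and>
        (\<forall>(x, \<xi>) \<in> half_plane. u x \<xi> 0 \<le> 0)
        \<longrightarrow> (\<forall>(x, \<xi>) \<in> half_plane. \<forall>t \<in> time_open T. u x \<xi> t \<le> 0))
     \<and>
     (\<forall>(f :: real \<Rightarrow> real \<Rightarrow> real \<Rightarrow> real) (u\<^sub>0 :: real \<Rightarrow> real \<Rightarrow> real)
        (u :: real \<Rightarrow> real \<Rightarrow> real \<Rightarrow> real) (v :: real \<Rightarrow> real \<Rightarrow> real \<Rightarrow> real).
        heston_strong_solution T \<sigma> \<rho> q\<^sub>r \<kappa> \<theta> f u\<^sub>0 u \<and>
        (\<exists>C > 0. \<forall>(x, \<xi>) \<in> half_plane. \<forall>t \<in> time_halfopen T.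
           \<bar>u x \<xi> t\<bar> \<le> C * majorant \<beta>\<^sub>0 \<gamma>\<^sub>0 \<mu>\<^sub>0 x \<xi>) \<and>
        heston_strong_solution T \<sigma> \<rho> q\<^sub>r \<kappa> \<theta> f u\<^sub>0 v \<and>
        (\<exists>C > 0. \<forall>(x, \<xi>) \<in> half_plane. \<forall>t \<in> time_halfopen T.
           \<bar>v x \<xi> t\<bar> \<le> C * majorant \<beta>\<^sub>0 \<gamma>\<^sub>0 \<mu>\<^sub>0 x \<xi>)
        \<longrightarrow> (\<forall>(x, \<xi>) \<in> half_plane. \<forall>t \<in> time_halfopen T. u x \<xi> t = v x \<xi> t))"
proof -
  have \<rho>: "\<bar>\<rho>\<bar> \<le> 1" using \<open>-1 < \<rho>\<close> \<open>\<rho> < 1\<close> by simp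
  note params = \<open>0 < \<sigma>\<close> \<rho> \<open>0 < \<kappa>\<close> \<open>0 < \<theta>\<close> \<open>0 < \<gamma>\<^sub>0\<close> \<open>0 < \<mu>\<^sub>0\<close> \<open>1 \<le> \<beta>\<^sub>0\<close> \<open>\<beta>\<^sub>0 < 2 * \<kappa> * \<theta> / \<sigma>\<^sup>2\<close>
  show ?thesis
  proof (intro conjI allI impI)
    fix u :: "real \<Rightarrow> real \<Rightarrow> real \<Rightarrow> real"
    assume a: "cont_on_cylinder (time_halfopen T) u \<and> C21 T u \<and>
        (\<forall>(x, \<xi>) \<in> half_plane. \<forall>t \<in> time_open T.
           D_t u x \<xi> t + heston_op \<sigma> \<rho> q\<^sub>r \<kappa> \<theta> (slice u t) x \<xi> \<le> 0) \<and>
        (\<exists>C > 0. \<forall>(x, \<xi>) \<in> half_plane. \<forall>t \<in> time_open T.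
           u x \<xi> t \<le> C * majorant \<beta>\<^sub>0 \<gamma>\<^sub>0 \<mu>\<^sub>0 x \<xi>) \<and>
        (\<forall>(x, \<xi>) \<in> half_plane. u x \<xi> 0 \<le> 0)"
    then obtain C where C: "0 < C"
      "\<And>x y t. 0 < y \<Longrightarrow> t \<in> time_open T \<Longrightarrow> u x y t \<le> C * majorant \<beta>\<^sub>0 \<gamma>\<^sub>0 \<mu>\<^sub>0 x y"
      by fastforce
    have sub: "D_t u x y t + heston_op \<sigma> \<rho> q\<^sub>r \<kappa> \<theta> (slice u t) x y \<le> 0" if "0 < y" "t \<in> time_open T" for x y t
      using a that by fastforce
    have init: "u x y 0 \<le> 0" if "0 < y" for x y
      using a that by fastforce
    have "u x y t \<le> 0" if "0 < y" "t \<in> time_open T" for x y t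
    proof -
      have C21: "C21 T u" using a by blast
      have t: "t \<in> time_halfopen T" using that time_open_subset_halfopen by blast
      note sub1 = time_open_Ioc_subset[OF t] and sub2 = time_halfopen_Icc_subset[OF t]
      show ?thesis
      proof (rule heston_maximum_principle[OF params C21_jet_subset[OF C21_imp_jet[OF C21] sub1] _ C(1) sub[unfolded heston_op_eq_expr] C(2) init])
        show "cont_on_cylinder {0..t} u" using cont_on_cylinder_subset[OF _ sub2] a by blast
      qed (use sub1 that time_halfopen_nonneg[OF t] in auto)
    qed
    then show "\<forall>(x, \<xi>) \<in> half_plane. \<forall>t \<in> time_open T. u x \<xi> t \<le> 0" by auto
  next
    fix f :: "real \<Rightarrow> real \<Rightarrow> real \<Rightarrow> real" and u\<^sub>0 :: "real \<Rightarrow> real \<Rightarrow> real"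
      and u v :: "real \<Rightarrow> real \<Rightarrow> real \<Rightarrow> real"
    assume a: "heston_strong_solution T \<sigma> \<rho> q\<^sub>r \<kappa> \<theta> f u\<^sub>0 u \<and>
          (\<exists>C > 0. \<forall>(x, \<xi>) \<in> half_plane. \<forall>t \<in> time_halfopen T.
             \<bar>u x \<xi> t\<bar> \<le> C * majorant \<beta>\<^sub>0 \<gamma>\<^sub>0 \<mu>\<^sub>0 x \<xi>) \<and>
          heston_strong_solution T \<sigma> \<rho> q\<^sub>r \<kappa> \<theta> f u\<^sub>0 v \<and>
          (\<exists>C > 0. \<forall>(x, \<xi>) \<in> half_plane. \<forall>t \<in> time_halfopen T.
             \<bar>v x \<xi> t\<bar> \<le> C * majorant \<beta>\<^sub>0 \<gamma>\<^sub>0 \<mu>\<^sub>0 x \<xi>)"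
    then obtain A where A: "0 < A"
      "\<And>x y t. 0 < y \<Longrightarrow> t \<in> time_halfopen T \<Longrightarrow> \<bar>u x y t\<bar> \<le> A * majorant \<beta>\<^sub>0 \<gamma>\<^sub>0 \<mu>\<^sub>0 x y"
      by fastforce
    from a obtain B where B: "0 < B"
      "\<And>x y t. 0 < y \<Longrightarrow> t \<in> time_halfopen T \<Longrightarrow> \<bar>v x y t\<bar> \<le> B * majorant \<beta>\<^sub>0 \<gamma>\<^sub>0 \<mu>\<^sub>0 x y"
      by fastforce
    from a have u: "heston_strong_solution T \<sigma> \<rho> q\<^sub>r \<kappa> \<theta> f u\<^sub>0 u"
      and v: "heston_strong_solution T \<sigma> \<rho> q\<^sub>r \<kappa> \<theta> f u\<^sub>0 v" by auto
    \<comment> \<open>The hypotheses are symmetric in the two solutions, so the inequality holds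
      both ways.\<close>
    have "u x y t = v x y t" if "0 < y" "t \<in> time_halfopen T" for x y t
      using heston_solution_le[OF params u v A B that] heston_solution_le[OF params v u B A that]
      by (rule antisym)
    then show "\<forall>(x, \<xi>) \<in> half_plane. \<forall>t \<in> time_halfopen T. u x \<xi> t = v x \<xi> t" by auto
  qed
qed

end
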